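(* Let $p\in(-\infty,-1]\cup[0,\infty)$. Then for $t\in(0,\pi/2)$ the inequality $$\frac{2p+(p+3)\cos t}{(3p+1)+2\cos t}<\frac{\sin t}{t}$$ holds if and only if $p\in[0,p_0]$, where $p_0=(\pi-3)^{-1}\approx 7.063$. Moreover, for $p\in(0,p_1]$ and $t\in(0,\pi/2)$ we have $$H_1(\cos t,p)=\frac{2p+(p+3)\cos t}{(3p+1)+2\cos t}<\frac{\sin t}{t}<\lambda_p\,\frac{2p+(p+3)\cos t}{(3p+1)+2\cos t}=H_2(\cos t,p),$$ where $p_1\approx 6.343$ and $\lambda_p=\dfrac{3p+1}{\pi p}$ is the best possible. And $H_1(\cos t,p)$, $H_2(\cos t,p)$ are increasing and decreasing in $p$ on $(-\infty,-1]\cup(0,\infty)$, respectively. For $p\in(p_1,p_0]$ and $t\in(0,\pi/2)$ we have $$H_1(\cos t,p)=\frac{2p+(p+3)\cos t}{(3p+1)+2\cos t}<\frac{\sin t}{t}<\delta_p\,\frac{2p+(p+3)\cos t}{(3p+1)+2\cos t}=\delta_pH_1(\cos t,p),$$ where $$\delta_p=\frac{\sin t_0}{t_0}\cdot\frac{(3p+1)+2\cos t_0}{2p+(p+3)\cos t_0}$$ is the best possible and $t_0$ is the unique root on $(0,\pi/2)$ of the equation $$\frac{\bigl(2p+(3+p)\cos t\bigr)\bigl(3p+1+2\cos t\bigr)}{2(p+3)\cos^3t+8p\cos^2t+2p(3p+1)\cos t+3(p+1)^2}\,\sin t=t .$$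
   Context: $p_1=\dfrac{2\sqrt{6\pi+1}+3\pi-2}{12-3\pi}\approx 6.343$. For $x\in(0,1)$: $H_1(x,p)=\dfrac{2p+(p+3)x}{3p+1+2x}$ for $p\in(-\infty,-1]\cup[0,\infty)$, and $H_2(x,p)=\dfrac{3p+1}{\pi p}\cdot\dfrac{2p+(p+3)x}{(3p+1)+2x}$ for $p\in(-\infty,-1]\cup(0,\infty)$.
   Formalization: For p in (p1,p0] the upper bound is strict only for t ≠ t0 (at t = t0 equality holds by definition of δ_p), and monotonicity in p of H1 and H2 is asserted on (-∞,-1] and on (0,∞) separately, as it fails across the union. *)

theory Defs
  imports "HOL-Analysis.Analysis"
begin

definition p0 :: real where
  "p0 = inverse (pi - 3)"

definition p1 :: real where
  "p1 = (2 * sqrt (6 * pi + 1) + 3 * pi - 2) / (12 - 3 * pi)"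

text \<open>
  The two families are used only for \<open>0 < x < 1\<close> and for \<open>p \<le> -1\<close> or \<open>p \<ge> 0\<close>
  (\<open>p > 0\<close> in the case of \<open>H2\<close>); no denominator vanishes there.
\<close>

definition H1 :: "real \<Rightarrow> real \<Rightarrow> real" where
  "H1 x p = (2 * p + (p + 3) * x) / (3 * p + 1 + 2 * x)"

definition H2 :: "real \<Rightarrow> real \<Rightarrow> real" where
  "H2 x p = (3 * p + 1) / (pi * p) * ((2 * p + (p + 3) * x) / ((3 * p + 1) + 2 * x))"

definition lambda_const :: "real \<Rightarrow> real" where
  "lambda_const p = (3 * p + 1) / (pi * p)"

definition critical_point :: "real \<Rightarrow> real \<Rightarrow> bool" where
  "critical_point p t \<longleftrightarrow> 0 < t \<and> t < pi / 2 \<and>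
     ((2 * p + (3 + p) * cos t) * (3 * p + 1 + 2 * cos t))
       / (2 * (p + 3) * cos t ^ 3 + 8 * p * cos t ^ 2
            + 2 * p * (3 * p + 1) * cos t + 3 * (p + 1) ^ 2) * sin t = t"

text \<open>
  The constant \<open>\<delta>\<^sub>p\<close>, with the point \<open>t\<^sub>0\<close> at which it is evaluated
  passed as the argument \<open>t0\<close>.
\<close>

definition delta_const :: "real \<Rightarrow> real \<Rightarrow> real" where
  "delta_const p t0 =
     sin t0 / t0 * ((3 * p + 1 + 2 * cos t0) / (2 * p + (p + 3) * cos t0))"

text \<open>
  \<open>c\<close> is the least constant for which \<open>f \<le> c * g\<close> on \<open>S\<close>.  The comparison is
  non-strict so that the notion also covers a constant that is attained on \<open>S\<close>.
  If in addition \<open>f < c * g\<close> on \<open>S\<close>, then \<open>c\<close> is also the least constant for the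
  strict inequality.
\<close>

definition best_upper_const :: "real set \<Rightarrow> (real \<Rightarrow> real) \<Rightarrow> (real \<Rightarrow> real) \<Rightarrow> real \<Rightarrow> bool" where
  "best_upper_const S f g c \<longleftrightarrow>
     (\<forall>t\<in>S. f t \<le> c * g t) \<and> (\<forall>c'. (\<forall>t\<in>S. f t \<le> c' * g t) \<longrightarrow> c \<le> c')"

end

theory Submission
  imports Defs
begin

text \<open>
  Write \<open>c = cos t\<close>. All the bounds compare \<open>sin t / t\<close> with a multiple of
  \<open>H1 c p\<close>, so they are statements about the range of the quotient
  \<open>R t = sin t / (t * H1 c p)\<close> on \<open>[0, pi/2]\<close>, where \<open>R 0 = 1\<close> and \<open>R (pi/2) = lambda_const p\<close>.

  Differentiating, \<open>R'\<close> is a positive multiple of \<open>\<phi> t = t - Q c / K c * sin t\<close> (\<open>defect\<close>), where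
  \<open>Q c / K c * sin t = t\<close> is the equation that defines the critical point. Differentiating
  again eliminates the isolated \<open>t\<close>: \<open>\<phi>'\<close> is a positive multiple of a cubic in \<open>c\<close>
  (\<open>defect_slope_identity\<close>). Apart from the constant term, the coefficients of
  this cubic are positive, so it increases with \<open>c\<close> and \<open>\<phi>'\<close> can change sign only once, from
  plus to minus. Hence \<open>\<phi>\<close> is strictly quasiconcave (\<open>strictly_quasiconcave\<close>), and as
  \<open>\<phi> 0 = 0\<close> it too changes sign at most once, from plus to minus. So \<open>R\<close> first increases and
  then decreases, where one of the two phases may be absent, and it increases throughout exactly when
  \<open>\<phi> (pi/2) \<ge> 0\<close>.

  Everything follows from this shape. It gives \<open>R > min 1 (lambda_const p)\<close> inside the
  interval, and \<open>lambda_const p \<ge> 1\<close> means \<open>p \<le> p0\<close>; this gives the lower bound, and letting \<open>t\<close>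
  tend to \<open>pi/2\<close> shows that \<open>p \<le> p0\<close> is necessary. The condition \<open>\<phi> (pi/2) \<ge> 0\<close> is quadratic in
  \<open>p\<close> and means \<open>p \<le> p1\<close>; then \<open>R\<close> increases and its supremum is the limit \<open>lambda_const p\<close>. For
  \<open>p1 < p \<le> p0\<close> the zero \<open>t0\<close> of \<open>\<phi>\<close> is the place of the maximum, and \<open>delta_const p t0 = R t0\<close>.

  The monotonicity in \<open>p\<close> is separate and algebraic: both differences factor into pieces of known
  sign (\<open>H1_less\<close>, \<open>H2_greater\<close>).
\<close>

section \<open>Functions whose derivative changes sign once\<close>
lemma mvt_real_derivative:
  fixes f f' :: "real \<Rightarrow> real"
  assumes "u < v" "continuous_on {u..v} f"
    and "\<And>t. u < t \<Longrightarrow> t < v \<Longrightarrow> (f has_real_derivative f' t) (at t)"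
  obtains r where "u < r" "r < v" "f v - f u = f' r * (v - u)"
  using mvt[OF assms(1,2), of "\<lambda>r h. f' r * h"] assms(3)
  by (auto simp flip: has_field_derivative_def)

text \<open>
  If \<open>f y\<close> were at most both \<open>f x\<close> and \<open>f z\<close>, the mean value theorem would give a point left of \<open>y\<close>
  with nonpositive derivative and a later point with nonnegative derivative, against the sign
  hypothesis. Stated this way, the shape of \<open>f\<close> can be used without locating its maximum.
\<close>
lemma strictly_quasiconcave:
  fixes f f' :: "real \<Rightarrow> real"
  assumes cont: "continuous_on {a..b} f"
    and deriv: "\<And>t. a < t \<Longrightarrow> t < b \<Longrightarrow> (f has_real_derivative f' t) (at t)"
    and sign: "\<And>s t. a < s \<Longrightarrow> s < t \<Longrightarrow> t < b \<Longrightarrow> f' s \<le> 0 \<Longrightarrow> f' t < 0"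
    and ord: "a \<le> x" "x < y" "y < z" "z \<le> b"
  shows "min (f x) (f z) < f y"
proof (rule ccontr)
  assume "\<not> ?thesis"
  then have le: "f y \<le> f x" "f y \<le> f z" by auto
  obtain r where r: "x < r" "r < y" "f y - f x = f' r * (y - x)"
    by (rule mvt_real_derivative[of x y f f'])
       (use ord deriv in \<open>auto intro: continuous_on_subset[OF cont]\<close>)
  obtain s where s: "y < s" "s < z" "f z - f y = f' s * (z - y)"
    by (rule mvt_real_derivative[of y z f f'])
       (use ord deriv in \<open>auto intro: continuous_on_subset[OF cont]\<close>)
  have "f' r * (y - x) \<le> 0" using le r by simp
  then have "f' r \<le> 0" using ord by (simp add: mult_le_0_iff)
  then have "f' s < 0" using sign[of r s] r s ord by linarith
  then have "f' s * (z - y) < 0" using ord by (simp add: mult_neg_pos)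
  then show False using le s by simp
qed

section \<open>The family of Moebius functions\<close>

definition numer :: "real \<Rightarrow> real \<Rightarrow> real" where
  "numer p x = 2 * p + (p + 3) * x"

definition denom :: "real \<Rightarrow> real \<Rightarrow> real" where
  "denom p x = 3 * p + 1 + 2 * x"

lemma H1_eq: "H1 x p = numer p x / denom p x"
  by (simp add: H1_def numer_def denom_def)

lemma H2_eq: "H2 x p = lambda_const p * H1 x p"
  by (simp add: H1_def H2_def lambda_const_def)

lemma numer_pos: "0 < p \<Longrightarrow> 0 \<le> x \<Longrightarrow> 0 < numer p x"
  unfolding numer_def by (intro add_pos_nonneg) auto

lemma denom_pos: "0 \<le> p \<Longrightarrow> 0 \<le> x \<Longrightarrow> 0 < denom p x"
  unfolding denom_def by linarith

lemma denom_neg: "p \<le> -1 \<Longrightarrow> x < 1 \<Longrightarrow> denom p x < 0"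
  unfolding denom_def by linarith

lemma H1_pos: "0 < p \<Longrightarrow> 0 \<le> x \<Longrightarrow> 0 < H1 x p"
  by (simp add: H1_eq numer_pos denom_pos)

lemma same_branch_mult_pos:
  fixes p q :: real
  assumes "p \<le> -1 \<and> q \<le> -1 \<or> 0 \<le> p \<and> 0 \<le> q" and x: "0 < x" "x < 1"
  shows "0 < denom p x * denom q x"
  using assms(1)
proof
  assume "p \<le> -1 \<and> q \<le> -1"
  then show ?thesis using x by (intro mult_neg_neg denom_neg) auto
next
  assume "0 \<le> p \<and> 0 \<le> q"
  then show ?thesis using x by (intro mult_pos_pos denom_pos) auto
qed

text \<open>
  Cross-multiplying, the numerator of the difference is \<open>2 * (q - p) * (1 - x)\<^sup>2\<close>. Since
  \<open>denom\<close> has constant sign for \<open>p \<le> -1\<close> and for \<open>p \<ge> 0\<close>, but not the same one, the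
  parameters have to lie in the same half-line.
\<close>
lemma H1_less:
  assumes "p < q" and br: "p \<le> -1 \<and> q \<le> -1 \<or> 0 \<le> p \<and> 0 \<le> q" and x: "0 < x" "x < 1"
  shows "H1 x p < H1 x q"
proof -
  have pos: "0 < denom p x * denom q x" using same_branch_mult_pos[OF br x] .
  then have nz: "denom p x \<noteq> 0" "denom q x \<noteq> 0" by auto
  have "numer q x * denom p x - numer p x * denom q x = 2 * (q - p) * (1 - x)\<^sup>2"
    by (simp add: numer_def denom_def algebra_simps power2_eq_square)
  then have "H1 x q - H1 x p = 2 * (q - p) * (1 - x)\<^sup>2 / (denom p x * denom q x)"
    using nz by (simp add: H1_eq field_simps)
  also have "\<dots> > 0" using pos assms by simp
  finally show ?thesis by simp
qed

text \<open>
  The numerator of the difference contains the symmetric form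
  \<open>(5 - 2 * x) * p * q + 3 * (p + q) + 1 + 2 * x\<close>. It is obviously positive for \<open>p, q > 0\<close>; on the
  other half-line it is rewritten in the nonnegative quantities \<open>-1 - p\<close> and \<open>-1 - q\<close>, where its constant
  term disappears.
\<close>
lemma H2_greater:
  assumes "p < q" and br: "p \<le> -1 \<and> q \<le> -1 \<or> 0 < p \<and> 0 < q" and x: "0 < x" "x < 1"
  shows "H2 x q < H2 x p"
proof -
  have pos: "0 < denom p x * denom q x" using br by (intro same_branch_mult_pos x) auto
  then have nz: "denom p x \<noteq> 0" "denom q x \<noteq> 0" "p \<noteq> 0" "q \<noteq> 0" using br by auto
  have pq: "0 < p * q" using br by (auto intro: mult_pos_pos mult_neg_neg)
  let ?F = "(5 - 2 * x) * (p * q) + 3 * (p + q) + (1 + 2 * x)"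
  have F: "0 < ?F"
  proof (cases "0 < p \<and> 0 < q")
    case True
    then show ?thesis using x pq by (intro add_nonneg_pos add_nonneg_nonneg) auto
  next
    case False
    then have le: "p \<le> -1" "q \<le> -1" using br by auto
    have "?F = (5 - 2 * x) * ((-1 - p) * (-1 - q)) + (2 - 2 * x) * ((-1 - p) + (-1 - q))"
      by (simp add: algebra_simps)
    moreover have "0 < (2 - 2 * x) * ((-1 - p) + (-1 - q))"
      using le x \<open>p < q\<close> by (intro mult_pos_pos) auto
    moreover have "0 \<le> (5 - 2 * x) * ((-1 - p) * (-1 - q))"
      using le x by (intro mult_nonneg_nonneg) auto
    ultimately show ?thesis by linarith
  qed
  have "(3 * p + 1) * numer p x * (q * denom q x) - (3 * q + 1) * numer q x * (p * denom p x)
      = (q - p) * (3 * x) * ?F"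
    unfolding numer_def denom_def by algebra
  then have "H2 x p - H2 x q
      = (q - p) * (3 * x) * ?F / (pi * (p * q) * (denom p x * denom q x))"
    using nz by (simp add: H2_eq H1_eq lambda_const_def divide_simps)
  also have "\<dots> > 0"
    using F x \<open>p < q\<close> by (intro divide_pos_pos mult_pos_pos[OF mult_pos_pos] pos pq) auto
  finally show ?thesis by simp
qed

section \<open>The critical-point equation\<close>

definition crit_num :: "real \<Rightarrow> real \<Rightarrow> real" where
  "crit_num p x = numer p x * denom p x"

definition crit_den :: "real \<Rightarrow> real \<Rightarrow> real" where
  "crit_den p x = 2 * (p + 3) * x ^ 3 + 8 * p * x\<^sup>2 + 2 * p * (3 * p + 1) * x + 3 * (p + 1)\<^sup>2"

text \<open>
  Subtracting from \<open>t\<close>, rather than keeping a product such as \<open>t * crit_den\<close>, makes the derivative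
  a rational function of \<open>cos t\<close> alone.
\<close>
definition defect :: "real \<Rightarrow> real \<Rightarrow> real" where
  "defect p t = t - crit_num p (cos t) / crit_den p (cos t) * sin t"

text \<open>
  The cubic that remains of the numerator of the derivative of \<open>defect\<close> when the factor
  \<open>(1 - x\<^sup>2) * (1 - x)\<close>, with \<open>x = cos t\<close>, is split off.
\<close>
definition defect_slope :: "real \<Rightarrow> real \<Rightarrow> real" where
  "defect_slope p x = 4 * (p + 3)\<^sup>2 * x ^ 3 + 6 * (p + 3) * (p\<^sup>2 + 8 * p + 3) * x\<^sup>2
     + 6 * (5 * p ^ 3 + 35 * p\<^sup>2 + 31 * p + 9) * x
     + (- 18 * p ^ 4 + 72 * p ^ 3 + 152 * p\<^sup>2 + 96 * p + 18)"

lemma critical_point_iff: "critical_point p t \<longleftrightarrow> 0 < t \<and> t < pi / 2 \<and> defect p t = 0"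
  by (auto simp: critical_point_def defect_def crit_num_def crit_den_def numer_def denom_def
      add.commute)

lemma crit_den_pos:
  assumes "0 < p" "0 \<le> x"
  shows "0 < crit_den p x"
  unfolding crit_den_def using assms by (intro add_nonneg_pos add_nonneg_nonneg) auto

text \<open>
  This is the form in which \<open>crit_den\<close> arises from differentiating the quotient of
  \<open>sin t / t\<close> by \<open>H1 (cos t) p\<close>.
\<close>
lemma crit_den_eq: "crit_den p x = x * crit_num p x + 3 * (p + 1)\<^sup>2 * (1 - x\<^sup>2)"
  unfolding crit_den_def crit_num_def numer_def denom_def by algebra

lemma defect_slope_strict_mono:
  assumes p: "0 < p" and x: "0 < x" "x < y"
  shows "defect_slope p x < defect_slope p y"
proof -
  have "x ^ 3 \<le> y ^ 3" "x\<^sup>2 \<le> y\<^sup>2" using x by (auto intro: power_mono)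
  then have "4 * (p + 3)\<^sup>2 * x ^ 3 \<le> 4 * (p + 3)\<^sup>2 * y ^ 3"
    "6 * (p + 3) * (p\<^sup>2 + 8 * p + 3) * x\<^sup>2 \<le> 6 * (p + 3) * (p\<^sup>2 + 8 * p + 3) * y\<^sup>2"
    using p by (auto intro!: mult_left_mono)
  moreover have "6 * (5 * p ^ 3 + 35 * p\<^sup>2 + 31 * p + 9) * x < 6 * (5 * p ^ 3 + 35 * p\<^sup>2 + 31 * p + 9) * y"
    using p x by (intro mult_strict_left_mono) (auto intro!: add_nonneg_pos)
  ultimately show ?thesis unfolding defect_slope_def by linarith
qed

lemma has_real_derivative_crit_num:
  "(crit_num p has_real_derivative (3 * p\<^sup>2 + 14 * p + 3) + 4 * (p + 3) * x) (at x)"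
  unfolding crit_num_def numer_def denom_def
  by (auto intro!: derivative_eq_intros simp: algebra_simps power2_eq_square)

lemma has_real_derivative_crit_den:
  "(crit_den p has_real_derivative 6 * (p + 3) * x\<^sup>2 + 16 * p * x + 2 * p * (3 * p + 1)) (at x)"
  unfolding crit_den_def by (auto intro!: derivative_eq_intros simp: power2_eq_square)

text \<open>
  The left-hand side is the numerator that the quotient rule produces for the derivative of
  \<open>defect\<close>, with \<open>x\<close> for \<open>cos t\<close> and \<open>1 - x\<^sup>2\<close> for \<open>(sin t)\<^sup>2\<close>.
\<close>
lemma defect_slope_identity:
  "(crit_den p x)\<^sup>2
     - (x * crit_num p x - (1 - x\<^sup>2) * ((3 * p\<^sup>2 + 14 * p + 3) + 4 * (p + 3) * x)) * crit_den p x
     - (1 - x\<^sup>2) * crit_num p x * (6 * (p + 3) * x\<^sup>2 + 16 * p * x + 2 * p * (3 * p + 1))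
   = (1 - x\<^sup>2) * (1 - x) * defect_slope p x"
  unfolding crit_den_def crit_num_def numer_def denom_def defect_slope_def by algebra

lemma has_real_derivative_defect:
  assumes "crit_den p (cos t) \<noteq> 0"
  shows "(defect p has_real_derivative
           (sin t)\<^sup>2 * (1 - cos t) * defect_slope p (cos t) / (crit_den p (cos t))\<^sup>2) (at t)"
proof -
  let ?Q = "crit_num p (cos t)" and ?K = "crit_den p (cos t)"
  let ?Q' = "(3 * p\<^sup>2 + 14 * p + 3) + 4 * (p + 3) * cos t"
  let ?K' = "6 * (p + 3) * (cos t)\<^sup>2 + 16 * p * cos t + 2 * p * (3 * p + 1)"
  have Q: "((\<lambda>t. crit_num p (cos t)) has_real_derivative ?Q' * (- sin t)) (at t)"
    by (rule DERIV_chain2[OF has_real_derivative_crit_num]) (auto intro!: derivative_eq_intros)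
  have K: "((\<lambda>t. crit_den p (cos t)) has_real_derivative ?K' * (- sin t)) (at t)"
    by (rule DERIV_chain2[OF has_real_derivative_crit_den]) (auto intro!: derivative_eq_intros)
  let ?D = "1 - ((?Q' * (- sin t) * ?K - ?Q * (?K' * (- sin t))) / (?K * ?K) * sin t
      + cos t * 1 * (?Q / ?K))"
  have "(defect p has_real_derivative ?D) (at t)"
    unfolding defect_def by (rule derivative_eq_intros Q K assms refl)+
  moreover have "?D = (?K\<^sup>2 - (cos t * ?Q - (sin t)\<^sup>2 * ?Q') * ?K - (sin t)\<^sup>2 * ?Q * ?K') / ?K\<^sup>2"
    using assms by (simp add: field_simps power2_eq_square)
  moreover have "\<dots> = (sin t)\<^sup>2 * (1 - cos t) * defect_slope p (cos t) / ?K\<^sup>2"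
    using defect_slope_identity[of p "cos t"] by (simp add: sin_squared_eq)
  ultimately show ?thesis by (simp only:)
qed

lemma defect_0: "defect p 0 = 0"
  by (simp add: defect_def)

lemma continuous_on_defect:
  assumes "0 < p"
  shows "continuous_on {0..pi/2} (defect p)"
proof (rule DERIV_continuous_on)
  fix t assume "t \<in> {0..pi/2}"
  then have "0 \<le> cos t" by (auto intro: cos_ge_zero)
  then have "crit_den p (cos t) \<noteq> 0" using crit_den_pos[OF assms] by force
  from has_real_derivative_defect[OF this]
  show "(defect p has_real_derivative
           (sin t)\<^sup>2 * (1 - cos t) * defect_slope p (cos t) / (crit_den p (cos t))\<^sup>2) (at t within {0..pi/2})"
    by (rule has_field_derivative_at_within)
qed

text \<open>
  The derivative is a positive weight times \<open>defect_slope p (cos t)\<close>, which decreases in \<open>t\<close> because the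
  cubic increases and the cosine decreases. Once nonpositive it is therefore negative
  from then on.
\<close>
lemma defect_strictly_quasiconcave:
  assumes p: "0 < p" and ord: "0 \<le> x" "x < y" "y < z" "z \<le> pi / 2"
  shows "min (defect p x) (defect p z) < defect p y"
proof (rule strictly_quasiconcave[OF continuous_on_defect[OF p] _ _ ord])
  let ?d = "\<lambda>t. (sin t)\<^sup>2 * (1 - cos t) * defect_slope p (cos t) / (crit_den p (cos t))\<^sup>2"
  have weight: "0 < (sin t)\<^sup>2 * (1 - cos t) / (crit_den p (cos t))\<^sup>2"
    if "0 < t" "t < pi / 2" for t
  proof -
    have "0 < sin t" "0 < cos t" "cos t < 1"
      using that cos_monotone_0_pi[of 0 t] by (auto intro: sin_gt_zero cos_gt_zero)
    moreover have "0 < crit_den p (cos t)" using \<open>0 < cos t\<close> by (intro crit_den_pos[OF p]) simp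
    ultimately show ?thesis by simp
  qed
  show "(defect p has_real_derivative ?d t) (at t)" if "0 < t" "t < pi / 2" for t
    using that crit_den_pos[OF p, of "cos t"] cos_gt_zero[of t]
    by (intro has_real_derivative_defect) auto
  show "?d t < 0" if "0 < s" "s < t" "t < pi / 2" "?d s \<le> 0" for s t
  proof -
    have "(sin s)\<^sup>2 * (1 - cos s) / (crit_den p (cos s))\<^sup>2 * defect_slope p (cos s) \<le> 0"
      using that by simp
    then have "defect_slope p (cos s) \<le> 0"
      using weight[of s] that mult_pos_pos[of _ "defect_slope p (cos s)"] by (meson not_le order.strict_trans)
    moreover have "0 < cos t" "cos t < cos s"
      using that by (auto intro: cos_gt_zero cos_monotone_0_pi)
    ultimately have "defect_slope p (cos t) < 0"
      using defect_slope_strict_mono[OF p, of "cos t" "cos s"] by linarith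
    then have "(sin t)\<^sup>2 * (1 - cos t) / (crit_den p (cos t))\<^sup>2 * defect_slope p (cos t) < 0"
      using weight[of t] that by (intro mult_pos_neg) auto
    then show ?thesis by simp
  qed
qed

text \<open>
  A quasiconcave function that starts from \<open>0\<close> cannot recover once it is nonpositive. This is the
  single change of sign that is passed on to the derivative of \<open>ratio\<close>.
\<close>
lemma defect_nonpos_imp_neg:
  assumes "0 < p" "0 < s" "s < t" "t \<le> pi / 2" "defect p s \<le> 0"
  shows "defect p t < 0"
  using defect_strictly_quasiconcave[of p 0 s t] assms by (simp add: defect_0)

lemma defect_nonneg_imp_pos:
  assumes "0 < p" "0 < s" "s < t" "t \<le> pi / 2" "0 \<le> defect p t"
  shows "0 < defect p s"
  using defect_nonpos_imp_neg[of p s t] assms by linarith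

section \<open>The quotient of the two sides\<close>

text \<open>
  The value \<open>1\<close> at \<open>0\<close> is the continuous extension, so that monotonicity arguments may
  start at the endpoint itself.
\<close>
definition ratio :: "real \<Rightarrow> real \<Rightarrow> real" where
  "ratio p t = (if t = 0 then 1 else sin t / t / H1 (cos t) p)"

lemma ratio_0: "ratio p 0 = 1"
  by (simp add: ratio_def)

lemma ratio_pi_half: "ratio p (pi / 2) = lambda_const p"
  by (simp add: ratio_def lambda_const_def H1_def divide_simps)

text \<open>
  The derivative is taken of \<open>sin t * denom / (t * numer)\<close>, which agrees with \<open>ratio\<close> near every
  positive \<open>t\<close>. The two terms with \<open>(sin t)\<^sup>2\<close> combine to the factor \<open>3 * (p + 1)\<^sup>2\<close>, and
  \<open>crit_den\<close> appears through \<open>crit_den_eq\<close>. Including \<open>t = pi / 2\<close> yields the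
  continuity of \<open>ratio\<close> at that endpoint.
\<close>
lemma has_real_derivative_ratio:
  assumes p: "0 < p" and t: "0 < t" "t \<le> pi / 2"
  shows "(ratio p has_real_derivative
           defect p t * crit_den p (cos t) / (t * numer p (cos t))\<^sup>2) (at t)"
proof -
  have c: "0 \<le> cos t" using t by (auto intro: cos_ge_zero)
  let ?A = "numer p (cos t)" and ?B = "denom p (cos t)"
  have pos: "0 < ?A" "0 < ?B" "0 < crit_den p (cos t)"
    using p c by (auto intro: numer_pos denom_pos crit_den_pos)
  let ?r = "\<lambda>t. sin t * denom p (cos t) / (t * numer p (cos t))"
  let ?D = "((cos t * ?B + (2 * (- sin t)) * sin t) * (t * ?A)
      - (sin t * ?B) * (1 * ?A + ((p + 3) * (- sin t)) * t)) / ((t * ?A) * (t * ?A))"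
  have A: "((\<lambda>t. numer p (cos t)) has_real_derivative (p + 3) * (- sin t)) (at t)"
    unfolding numer_def by (auto intro!: derivative_eq_intros)
  have B: "((\<lambda>t. denom p (cos t)) has_real_derivative 2 * (- sin t)) (at t)"
    unfolding denom_def by (auto intro!: derivative_eq_intros)
  have "(?r has_real_derivative ?D) (at t)"
    by (rule derivative_eq_intros A B refl)+ (use t pos in auto)
  moreover have "?D = (t * crit_den p (cos t) - crit_num p (cos t) * sin t) / (t * ?A)\<^sup>2"
  proof -
    have s: "sin t * sin t = 1 - (cos t)\<^sup>2"
      by (simp add: sin_squared_eq flip: power2_eq_square)
    have "(cos t * ?B + (2 * (- sin t)) * sin t) * (t * ?A)
        - (sin t * ?B) * (1 * ?A + ((p + 3) * (- sin t)) * t)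
      = t * (cos t * (?A * ?B) + (sin t * sin t) * ((p + 3) * ?B - 2 * ?A)) - ?A * ?B * sin t"
      by (simp add: algebra_simps)
    also have "(p + 3) * ?B - 2 * ?A = 3 * (p + 1)\<^sup>2"
      by (simp add: numer_def denom_def algebra_simps power2_eq_square)
    finally show ?thesis
      by (simp add: s crit_den_eq crit_num_def power2_eq_square mult.commute mult.left_commute)
  qed
  moreover have "t * crit_den p (cos t) - crit_num p (cos t) * sin t
      = defect p t * crit_den p (cos t)"
    using pos by (simp add: defect_def left_diff_distrib)
  ultimately have "(?r has_real_derivative
      defect p t * crit_den p (cos t) / (t * ?A)\<^sup>2) (at t)" by simp
  moreover have "eventually (\<lambda>u. ratio p u = ?r u) (nhds t)"
    by (rule eventually_nhds_in_open[of "{0<..}", THEN eventually_mono])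
       (use t in \<open>auto simp: ratio_def H1_eq\<close>)
  ultimately show ?thesis
    by (subst DERIV_cong_ev[OF refl _ refl])
qed

lemma continuous_on_ratio:
  assumes p: "0 < p"
  shows "continuous_on {0..pi/2} (ratio p)"
  unfolding continuous_on_def
proof
  fix t assume t: "t \<in> {0..pi/2}"
  show "(ratio p \<longlongrightarrow> ratio p t) (at t within {0..pi/2})"
  proof (cases "t = 0")
    case False
    then have "isCont (ratio p) t"
      using t by (intro DERIV_isCont[OF has_real_derivative_ratio[OF p]]) auto
    then show ?thesis unfolding isCont_def by (rule tendsto_within_subset) simp
  next
    case True
    have sinc: "((\<lambda>t::real. sin t / t) \<longlongrightarrow> 1) (at 0)"
      using DERIV_sin[of "0::real"] by (simp add: DERIV_def)
    have "isCont (\<lambda>t. H1 (cos t) p) 0"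
      unfolding H1_def using p by (intro continuous_intros) auto
    moreover have "H1 (cos 0) p = 1" using p by (simp add: H1_def)
    ultimately have H: "((\<lambda>t. H1 (cos t) p) \<longlongrightarrow> 1) (at 0)" by (simp add: isCont_def)
    have "((\<lambda>t. sin t / t / H1 (cos t) p) \<longlongrightarrow> 1) (at 0)"
      using tendsto_divide[OF sinc H] by simp
    then have "(ratio p \<longlongrightarrow> 1) (at 0)"
      by (rule Lim_transform_eventually) (auto simp: ratio_def eventually_at_filter)
    then show ?thesis using tendsto_within_subset[OF _ subset_UNIV] True by (simp add: ratio_0)
  qed
qed

lemma ratio_slope_weight_pos:
  assumes "0 < p" "0 < t" "t \<le> pi / 2"
  shows "0 < crit_den p (cos t) / (t * numer p (cos t))\<^sup>2"
proof -
  have "0 \<le> cos t" using assms by (auto intro: cos_ge_zero)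
  then have "0 < crit_den p (cos t)" "0 < numer p (cos t)"
    using assms by (auto intro: crit_den_pos numer_pos)
  then show ?thesis using assms by simp
qed

lemma ratio_increasing:
  assumes p: "0 < p" and ord: "0 \<le> s" "s < t" "t \<le> pi / 2" and d: "0 \<le> defect p t"
  shows "ratio p s < ratio p t"
proof (rule DERIV_pos_imp_increasing_open[OF ord(2)])
  show "continuous_on {s..t} (ratio p)"
    by (rule continuous_on_subset[OF continuous_on_ratio[OF p]]) (use ord in auto)
  fix u assume u: "s < u" "u < t"
  then have "0 < defect p u" using defect_nonneg_imp_pos[OF p _ _ _ d] ord by auto
  then have "0 < defect p u * (crit_den p (cos u) / (u * numer p (cos u))\<^sup>2)"
    using ratio_slope_weight_pos[OF p, of u] u ord by (intro mult_pos_pos) auto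
  then show "\<exists>y. (ratio p has_real_derivative y) (at u) \<and> 0 < y"
    using has_real_derivative_ratio[OF p, of u] u ord by auto
qed

lemma ratio_decreasing:
  assumes p: "0 < p" and ord: "0 < s" "s < t" "t \<le> pi / 2" and d: "defect p s \<le> 0"
  shows "ratio p t < ratio p s"
proof (rule DERIV_neg_imp_decreasing_open[OF ord(2)])
  show "continuous_on {s..t} (ratio p)"
    by (rule continuous_on_subset[OF continuous_on_ratio[OF p]]) (use ord in auto)
  fix u assume u: "s < u" "u < t"
  then have "defect p u < 0" using defect_nonpos_imp_neg[OF p _ _ _ d] ord by auto
  then have "defect p u * (crit_den p (cos u) / (u * numer p (cos u))\<^sup>2) < 0"
    using ratio_slope_weight_pos[OF p, of u] u ord by (intro mult_neg_pos) auto
  then show "\<exists>y. (ratio p has_real_derivative y) (at u) \<and> y < 0"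
    using has_real_derivative_ratio[OF p, of u] u ord by auto
qed

text \<open>
  Where \<open>defect\<close> is nonnegative, \<open>ratio\<close> has been increasing since \<open>0\<close>; where it is nonpositive,
  \<open>ratio\<close> decreases up to \<open>pi / 2\<close>. So one of the endpoint values always lies below.
\<close>
lemma ratio_gt_min_endpoints:
  assumes p: "0 < p" and t: "0 < t" "t < pi / 2"
  shows "min 1 (lambda_const p) < ratio p t"
  using ratio_increasing[OF p, of 0 t] ratio_decreasing[OF p, of t "pi / 2"] t
  by (cases "0 \<le> defect p t") (auto simp: ratio_0 ratio_pi_half min_less_iff_disj)

lemma tendsto_ratio_pi_half:
  assumes "0 < p"
  shows "(ratio p \<longlongrightarrow> lambda_const p) (at_left (pi / 2))"
proof -
  have "isCont (ratio p) (pi / 2)"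
    using has_real_derivative_ratio[OF assms, of "pi / 2"] by (auto intro: DERIV_isCont)
  then have "(ratio p \<longlongrightarrow> ratio p (pi / 2)) (at_left (pi / 2))"
    unfolding isCont_def by (rule tendsto_within_subset) simp
  then show ?thesis by (simp only: ratio_pi_half)
qed

lemma
  assumes p: "0 < p" and t: "0 < t" "t < pi / 2"
  shows H1_less_sinc_iff: "H1 (cos t) p < sin t / t \<longleftrightarrow> 1 < ratio p t"
    and sinc_less_iff: "sin t / t < c * H1 (cos t) p \<longleftrightarrow> ratio p t < c"
    and sinc_le_iff: "sin t / t \<le> c * H1 (cos t) p \<longleftrightarrow> ratio p t \<le> c"
proof -
  have "0 < H1 (cos t) p" using p t by (intro H1_pos) (auto intro: cos_ge_zero)
  then show "H1 (cos t) p < sin t / t \<longleftrightarrow> 1 < ratio p t"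
    "sin t / t < c * H1 (cos t) p \<longleftrightarrow> ratio p t < c"
    "sin t / t \<le> c * H1 (cos t) p \<longleftrightarrow> ratio p t \<le> c"
    using t by (simp_all only: ratio_def less_divide_eq_1_pos pos_divide_less_eq pos_divide_le_eq
        if_False less_irrefl simp_thms order_less_imp_not_eq2)
qed

section \<open>The threshold parameters\<close>

lemma p0_altdef: "p0 = 1 / (pi - 3)"
  by (simp add: p0_def divide_inverse)

lemma p0_pos: "0 < p0"
  using pi_gt3 by (simp add: p0_def)

lemma p1_pos: "0 < p1"
proof -
  have "0 \<le> sqrt (6 * pi + 1)" by simp
  then show ?thesis
    unfolding p1_def using pi_gt3 pi_less_4 by (intro divide_pos_pos) linarith+
qed

lemma one_le_lambda_const_iff:
  assumes "0 < p"
  shows "1 \<le> lambda_const p \<longleftrightarrow> p \<le> p0"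
  using assms pi_gt3 by (simp add: lambda_const_def p0_altdef field_simps)

text \<open>
  The condition at \<open>pi / 2\<close> is \<open>(12 - 3 * pi) * p\<^sup>2 - 2 * (3 * pi - 2) * p - 3 * pi \<le> 0\<close>. Its roots
  have negative product, so among positive \<open>p\<close> only the larger root, which is \<open>p1\<close>, matters. The proof
  completes the square.
\<close>
lemma defect_pi_half_nonneg_iff:
  assumes p: "0 < p"
  shows "0 \<le> defect p (pi / 2) \<longleftrightarrow> p \<le> p1"
proof -
  \<comment> \<open>With these, \<open>p1 = (r + e) / d\<close>, and \<open>(d * p - e)\<^sup>2 - r\<^sup>2\<close> is \<open>d\<close> times the quadratic.\<close>
  define d e r where "d = 12 - 3 * pi" and "e = 3 * pi - 2" and "r = 2 * sqrt (6 * pi + 1)"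
  have d: "0 < d" using pi_less_4 by (simp add: d_def)
  have r: "0 \<le> r" "r\<^sup>2 = 4 * (6 * pi + 1)" by (simp_all add: r_def power_mult_distrib)
  have "r\<^sup>2 - e\<^sup>2 = 9 * pi * (4 - pi)"
    unfolding r by (simp add: e_def power2_eq_square algebra_simps)
  also have "0 < \<dots>" using pi_less_4 by simp
  finally have er: "e < r" using r by (simp add: power2_less_imp_less)
  have "0 \<le> defect p (pi / 2) \<longleftrightarrow> 2 * p * (3 * p + 1) / (3 * (p + 1)\<^sup>2) \<le> pi / 2"
    by (simp add: defect_def crit_num_def crit_den_def numer_def denom_def)
  also have "\<dots> \<longleftrightarrow> 4 * p * (3 * p + 1) \<le> pi * (3 * (p + 1)\<^sup>2)"
    using p by (simp add: divide_le_eq algebra_simps)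
  also have "\<dots> \<longleftrightarrow> d * (4 * p * (3 * p + 1)) \<le> d * (pi * (3 * (p + 1)\<^sup>2))"
    using d by (rule mult_le_cancel_left_pos[symmetric])
  also have "\<dots> \<longleftrightarrow> (d * p - e)\<^sup>2 \<le> r\<^sup>2"
    unfolding r by (simp add: d_def e_def power2_eq_square algebra_simps)
  also have "\<dots> \<longleftrightarrow> \<bar>d * p - e\<bar> \<le> r"
    using r(1) by (simp flip: abs_le_square_iff)
  also have "\<dots> \<longleftrightarrow> d * p \<le> r + e"
    using er mult_pos_pos[OF d p] by auto
  also have "\<dots> \<longleftrightarrow> p \<le> p1"
    using d by (simp add: p1_def d_def e_def r_def field_simps)
  finally show ?thesis .
qed

lemma p0_approx: "\<bar>p0 - 7.063\<bar> < 0.0005"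
proof -
  have "7.0625 < p0" "p0 < 7.0635"
    using pi_approx by (auto simp: p0_altdef field_simps)
  then show ?thesis unfolding abs_less_iff by simp
qed

lemma p1_approx: "\<bar>p1 - 6.343\<bar> < 0.0005"
proof -
  have "4.455 < sqrt (6 * pi + 1)" "sqrt (6 * pi + 1) < 4.4553"
    using pi_approx by (intro real_less_rsqrt real_less_lsqrt; simp add: power2_eq_square)+
  then have "6.3425 < p1" "p1 < 6.3435"
    using pi_approx by (auto simp: p1_def field_simps)
  then show ?thesis unfolding abs_less_iff by simp
qed

lemma p1_less_p0: "p1 < p0"
  using p0_approx p1_approx unfolding abs_less_iff by simp

section \<open>The two-sided bounds\<close>

text \<open>
  By monotonicity in \<open>p\<close> it is enough to treat \<open>p = p0\<close>, where both endpoint values of \<open>ratio\<close> are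
  \<open>1\<close>. This also covers \<open>p = 0\<close>, where \<open>H1\<close> vanishes at \<open>pi / 2\<close> and \<open>ratio\<close> is
  unbounded.
\<close>
lemma H1_less_sinc:
  assumes p: "0 \<le> p" "p \<le> p0" and t: "0 < t" "t < pi / 2"
  shows "H1 (cos t) p < sin t / t"
proof -
  have "1 < ratio p0 t"
    using ratio_gt_min_endpoints[OF p0_pos t] one_le_lambda_const_iff[OF p0_pos] by simp
  then have p0: "H1 (cos t) p0 < sin t / t" using H1_less_sinc_iff[OF p0_pos t] by simp
  show ?thesis
  proof (cases "p = p0")
    case False
    have "0 < cos t" "cos t < 1"
      using t cos_monotone_0_pi[of 0 t] by (auto intro: cos_gt_zero)
    then have "H1 (cos t) p < H1 (cos t) p0" using False p by (intro H1_less) auto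
    then show ?thesis using p0 by simp
  qed (use p0 in simp)
qed

text \<open>
  Letting \<open>t\<close> tend to \<open>pi / 2\<close> turns the inequality into \<open>2 * p / (3 * p + 1) \<le> 2 / pi\<close>. For
  \<open>p \<le> -1\<close> the left-hand side exceeds \<open>2 / 3\<close>, which is impossible as \<open>pi > 3\<close>; for \<open>p \<ge> 0\<close> it
  says \<open>p \<le> p0\<close>.
\<close>
lemma H1_less_sinc_imp_le_p0:
  assumes p: "p \<le> -1 \<or> 0 \<le> p"
    and less: "\<And>t. 0 < t \<Longrightarrow> t < pi / 2 \<Longrightarrow> H1 (cos t) p < sin t / t"
  shows "0 \<le> p \<and> p \<le> p0"
proof -
  have nz: "3 * p + 1 \<noteq> 0" using p by auto
  have "isCont (\<lambda>t. H1 (cos t) p) (pi / 2)" "isCont (\<lambda>t::real. sin t / t) (pi / 2)"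
    unfolding H1_def using nz by (auto intro!: continuous_intros)
  then have lims: "((\<lambda>t. H1 (cos t) p) \<longlongrightarrow> H1 (cos (pi / 2)) p) (at_left (pi / 2))"
    "((\<lambda>t. sin t / t) \<longlongrightarrow> sin (pi / 2) / (pi / 2)) (at_left (pi / 2))"
    unfolding isCont_def by (auto elim: tendsto_within_subset)
  have "eventually (\<lambda>t. t \<in> {0<..<pi/2}) (at_left (pi / 2))"
    by (rule eventually_at_leftI[of 0]) auto
  then have "eventually (\<lambda>t. H1 (cos t) p \<le> sin t / t) (at_left (pi / 2))"
    by eventually_elim (use less in force)
  from tendsto_le[OF _ lims(2,1) this]
  have le: "2 * p / (3 * p + 1) \<le> 2 / pi" by (simp add: H1_def)
  show ?thesis
  proof (cases "0 \<le> p")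
    case True
    then have "2 * p * pi \<le> 2 * (3 * p + 1)" using le by (simp add: divide_le_eq le_divide_eq mult.commute)
    then show ?thesis using True pi_gt3 by (simp add: p0_altdef field_simps)
  next
    case False
    then have "3 * p + 1 < 0" using p by auto
    then have "2 * (3 * p + 1) \<le> 2 * p * pi" using le by (simp add: divide_le_eq le_divide_eq mult.commute)
    moreover have "p * pi \<le> p * 3" using False pi_gt3 by (intro mult_left_mono_neg) auto
    ultimately show ?thesis by simp
  qed
qed

lemma sinc_less_lambda_H1:
  assumes p: "0 < p" "p \<le> p1" and t: "0 < t" "t < pi / 2"
  shows "sin t / t < lambda_const p * H1 (cos t) p"
proof -
  have "0 \<le> defect p (pi / 2)" using defect_pi_half_nonneg_iff[OF p(1)] p(2) by simp
  then have "ratio p t < ratio p (pi / 2)" using t by (intro ratio_increasing[OF p(1)]) auto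
  then show ?thesis using sinc_less_iff[OF p(1) t] by (simp add: ratio_pi_half)
qed

text \<open>The constant is not attained; it is the limit of \<open>ratio\<close> at \<open>pi / 2\<close>.\<close>
lemma best_upper_const_lambda:
  assumes p: "0 < p" "p \<le> p1"
  shows "best_upper_const {0<..<pi/2} (\<lambda>t. sin t / t) (\<lambda>t. H1 (cos t) p) (lambda_const p)"
  unfolding best_upper_const_def
proof (intro conjI ballI allI impI)
  show "sin t / t \<le> lambda_const p * H1 (cos t) p" if "t \<in> {0<..<pi/2}" for t
    using sinc_less_lambda_H1[OF p, of t] that by auto
next
  fix c assume c: "\<forall>t\<in>{0<..<pi/2}. sin t / t \<le> c * H1 (cos t) p"
  have "eventually (\<lambda>t. t \<in> {0<..<pi/2}) (at_left (pi / 2))"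
    by (rule eventually_at_leftI[of 0]) auto
  then have "eventually (\<lambda>t. ratio p t \<le> c) (at_left (pi / 2))"
    by eventually_elim (use c sinc_le_iff[OF p(1)] in auto)
  then show "lambda_const p \<le> c"
    by (intro tendsto_upperbound[OF tendsto_ratio_pi_half[OF p(1)]]) auto
qed

text \<open>
  At \<open>pi / 2\<close> the defect is negative because \<open>p > p1\<close>. It is positive somewhere because
  \<open>p \<le> p0\<close> makes \<open>ratio\<close> exceed its initial value \<open>1\<close>, so that its derivative is positive at
  some point. The intermediate value theorem gives a zero between, and the single sign change
  makes it unique.
\<close>
lemma ex1_critical_point:
  assumes p: "p1 < p" "p \<le> p0"
  shows "\<exists>!t0. critical_point p t0"
proof (rule ex_ex1I)
  have "0 < p" using p p1_pos by simp
  have neg: "defect p (pi / 2) < 0" using defect_pi_half_nonneg_iff[OF \<open>0 < p\<close>] p by auto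
  \<comment> \<open>Any interior point serves in place of \<open>pi / 4\<close>.\<close>
  have one: "ratio p 0 < ratio p (pi / 4)"
    using ratio_gt_min_endpoints[OF \<open>0 < p\<close>, of "pi / 4"] one_le_lambda_const_iff[OF \<open>0 < p\<close>] p
    by (simp add: ratio_0)
  obtain x where x: "0 < x" "x < pi / 4" and
    mean: "ratio p (pi / 4) - ratio p 0
      = defect p x * crit_den p (cos x) / (x * numer p (cos x))\<^sup>2 * (pi / 4 - 0)"
    by (rule mvt_real_derivative[of 0 "pi / 4" "ratio p"
          "\<lambda>t. defect p t * crit_den p (cos t) / (t * numer p (cos t))\<^sup>2"])
       (use \<open>0 < p\<close> in \<open>auto intro: has_real_derivative_ratio
          continuous_on_subset[OF continuous_on_ratio]\<close>)
  have pos: "0 < defect p x"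
  proof (rule ccontr)
    assume "\<not> ?thesis"
    then have "defect p x * (crit_den p (cos x) / (x * numer p (cos x))\<^sup>2) \<le> 0"
      using ratio_slope_weight_pos[OF \<open>0 < p\<close>, of x] x by (intro mult_nonpos_nonneg) linarith+
    then have "defect p x * (crit_den p (cos x) / (x * numer p (cos x))\<^sup>2) * (pi / 4) \<le> 0"
      by (rule mult_nonpos_nonneg) simp
    then show False using mean one by simp
  qed
  have "continuous_on {x..pi/2} (defect p)"
    by (rule continuous_on_subset[OF continuous_on_defect[OF \<open>0 < p\<close>]]) (use x in auto)
  then obtain t0 where t0: "x \<le> t0" "t0 \<le> pi / 2" "defect p t0 = 0"
    using IVT2'[of "defect p" "pi / 2" 0 x] neg pos x by auto
  moreover have "t0 \<noteq> pi / 2" using t0(3) neg by (metis less_irrefl)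
  ultimately show "\<exists>t0. critical_point p t0"
    using x by (intro exI[of _ t0]) (simp add: critical_point_iff)
next
  fix s t assume "critical_point p s" "critical_point p t"
  moreover have "0 < p" using p p1_pos by simp
  ultimately show "s = t"
    using defect_nonpos_imp_neg[of p s t] defect_nonpos_imp_neg[of p t s]
    by (cases s t rule: linorder_cases) (auto simp: critical_point_iff)
qed

lemma ratio_less_at_critical_point:
  assumes p: "0 < p" and t0: "critical_point p t0" and t: "0 < t" "t < pi / 2" "t \<noteq> t0"
  shows "ratio p t < ratio p t0"
  using ratio_increasing[OF p, of t t0] ratio_decreasing[OF p, of t0 t] t t0
  by (cases t t0 rule: linorder_cases) (auto simp: critical_point_iff)

lemma delta_const_eq_ratio:
  assumes "0 < t"
  shows "delta_const p t = ratio p t"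
  using assms by (simp add: delta_const_def ratio_def H1_def add.commute)

lemma best_upper_const_delta:
  assumes p: "0 < p" and t0: "critical_point p t0"
  shows "best_upper_const {0<..<pi/2} (\<lambda>t. sin t / t) (\<lambda>t. H1 (cos t) p) (delta_const p t0)"
proof -
  have t0': "0 < t0" "t0 < pi / 2" using t0 by (auto simp: critical_point_iff)
  show ?thesis
    unfolding best_upper_const_def delta_const_eq_ratio[OF t0'(1)]
  proof (intro conjI ballI allI impI)
    show "sin t / t \<le> ratio p t0 * H1 (cos t) p" if "t \<in> {0<..<pi/2}" for t
      using ratio_less_at_critical_point[OF p t0, of t] sinc_le_iff[OF p, of t] that
      by (cases "t = t0") auto
    show "ratio p t0 \<le> c" if "\<forall>t\<in>{0<..<pi/2}. sin t / t \<le> c * H1 (cos t) p" for c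
      using that sinc_le_iff[OF p t0', THEN iffD1] t0' by simp
  qed
qed

theorem theorem2:
  shows
    "(\<forall>p::real. p \<in> {..-1} \<union> {0..} \<longrightarrow>
        ((\<forall>t\<in>{0<..<pi/2}.
            (2 * p + (p + 3) * cos t) / ((3 * p + 1) + 2 * cos t) < sin t / t)
          \<longleftrightarrow> p \<in> {0..p0}))
     \<and> \<bar>p0 - 7.063\<bar> < 0.0005
     \<and> (\<forall>p\<in>{0<..p1}.
          (\<forall>t\<in>{0<..<pi/2}.
             H1 (cos t) p = (2 * p + (p + 3) * cos t) / ((3 * p + 1) + 2 * cos t)
             \<and> (2 * p + (p + 3) * cos t) / ((3 * p + 1) + 2 * cos t) < sin t / t
             \<and> sin t / t
                 < lambda_const p * ((2 * p + (p + 3) * cos t) / ((3 * p + 1) + 2 * cos t))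
             \<and> lambda_const p * ((2 * p + (p + 3) * cos t) / ((3 * p + 1) + 2 * cos t))
                 = H2 (cos t) p)
          \<and> best_upper_const {0<..<pi/2} (\<lambda>t. sin t / t) (\<lambda>t. H1 (cos t) p) (lambda_const p))
     \<and> \<bar>p1 - 6.343\<bar> < 0.0005
     \<and> (\<forall>t\<in>{0<..<pi/2}.
          strict_mono_on {..-1} (\<lambda>p. H1 (cos t) p)
          \<and> strict_mono_on {0<..} (\<lambda>p. H1 (cos t) p)
          \<and> strict_antimono_on {..-1} (\<lambda>p. H2 (cos t) p)
          \<and> strict_antimono_on {0<..} (\<lambda>p. H2 (cos t) p))
     \<and> (\<forall>p\<in>{p1<..p0}.
          (\<exists>!t0. critical_point p t0)
          \<and> (\<forall>t0. critical_point p t0 \<longrightarrow>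
               (\<forall>t\<in>{0<..<pi/2}.
                  H1 (cos t) p = (2 * p + (p + 3) * cos t) / ((3 * p + 1) + 2 * cos t)
                  \<and> (2 * p + (p + 3) * cos t) / ((3 * p + 1) + 2 * cos t) < sin t / t
                  \<and> sin t / t \<le> delta_const p t0
                       * ((2 * p + (p + 3) * cos t) / ((3 * p + 1) + 2 * cos t))
                  \<and> (t \<noteq> t0 \<longrightarrow> sin t / t < delta_const p t0
                       * ((2 * p + (p + 3) * cos t) / ((3 * p + 1) + 2 * cos t)))
                  \<and> delta_const p t0
                       * ((2 * p + (p + 3) * cos t) / ((3 * p + 1) + 2 * cos t))
                      = delta_const p t0 * H1 (cos t) p)
               \<and> best_upper_const {0<..<pi/2} (\<lambda>t. sin t / t) (\<lambda>t. H1 (cos t) p)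
                    (delta_const p t0)))"
proof -
  have part1: "p \<in> {..-1} \<union> {0..} \<longrightarrow>
      ((\<forall>t\<in>{0<..<pi/2}. (2 * p + (p + 3) * cos t) / ((3 * p + 1) + 2 * cos t) < sin t / t)
        \<longleftrightarrow> p \<in> {0..p0})" for p
  proof (rule impI)
    assume p: "p \<in> {..-1} \<union> {0..}"
    have "(\<forall>t\<in>{0<..<pi/2}. H1 (cos t) p < sin t / t) \<longleftrightarrow> p \<in> {0..p0}"
    proof
      assume "\<forall>t\<in>{0<..<pi/2}. H1 (cos t) p < sin t / t"
      then show "p \<in> {0..p0}" using H1_less_sinc_imp_le_p0[of p] p by simp
    qed (simp add: H1_less_sinc)
    then show "(\<forall>t\<in>{0<..<pi/2}. (2 * p + (p + 3) * cos t) / ((3 * p + 1) + 2 * cos t) < sin t / t)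
        \<longleftrightarrow> p \<in> {0..p0}"
      by (simp only: H1_def)
  qed
  have cos01: "0 < cos t" "cos t < 1" if "t \<in> {0<..<pi/2}" for t
    using that cos_monotone_0_pi[of 0 t] by (auto intro: cos_gt_zero)
  have mono: "\<forall>t\<in>{0<..<pi/2}.
          strict_mono_on {..-1} (\<lambda>p. H1 (cos t) p)
          \<and> strict_mono_on {0<..} (\<lambda>p. H1 (cos t) p)
          \<and> strict_antimono_on {..-1} (\<lambda>p. H2 (cos t) p)
          \<and> strict_antimono_on {0<..} (\<lambda>p. H2 (cos t) p)"
    by (auto intro!: monotone_onI H1_less H2_greater cos01)
  have part2: "H1 (cos t) p = (2 * p + (p + 3) * cos t) / ((3 * p + 1) + 2 * cos t)
             \<and> (2 * p + (p + 3) * cos t) / ((3 * p + 1) + 2 * cos t) < sin t / t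
             \<and> sin t / t
                 < lambda_const p * ((2 * p + (p + 3) * cos t) / ((3 * p + 1) + 2 * cos t))
             \<and> lambda_const p * ((2 * p + (p + 3) * cos t) / ((3 * p + 1) + 2 * cos t))
                 = H2 (cos t) p"
    if "p \<in> {0<..p1}" "t \<in> {0<..<pi/2}" for p t
    using that p1_less_p0 H1_less_sinc[of p t] sinc_less_lambda_H1[of p t]
    by (auto simp: H1_def[symmetric] H2_eq)
  have part3: "H1 (cos t) p = (2 * p + (p + 3) * cos t) / ((3 * p + 1) + 2 * cos t)
                  \<and> (2 * p + (p + 3) * cos t) / ((3 * p + 1) + 2 * cos t) < sin t / t
                  \<and> sin t / t \<le> delta_const p t0
                       * ((2 * p + (p + 3) * cos t) / ((3 * p + 1) + 2 * cos t))
                  \<and> (t \<noteq> t0 \<longrightarrow> sin t / t < delta_const p t0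
                       * ((2 * p + (p + 3) * cos t) / ((3 * p + 1) + 2 * cos t)))
                  \<and> delta_const p t0
                       * ((2 * p + (p + 3) * cos t) / ((3 * p + 1) + 2 * cos t))
                      = delta_const p t0 * H1 (cos t) p"
    if "p \<in> {p1<..p0}" "critical_point p t0" "t \<in> {0<..<pi/2}" for p t0 t
  proof -
    have p: "0 < p" "p \<le> p0" using that p1_pos by auto
    have t: "0 < t" "t < pi / 2" "0 < t0" using that by (auto simp: critical_point_iff)
    have "sin t / t < delta_const p t0 * H1 (cos t) p" if "t \<noteq> t0"
      using ratio_less_at_critical_point[OF p(1) \<open>critical_point p t0\<close> t(1,2) that]
      by (simp add: sinc_less_iff[OF p(1) t(1,2)] delta_const_eq_ratio[OF t(3)])
    moreover have "sin t / t \<le> delta_const p t0 * H1 (cos t) p"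
      using best_upper_const_delta[OF p(1) that(2)] that(3) by (simp add: best_upper_const_def)
    ultimately show ?thesis
      using H1_less_sinc[OF less_imp_le[OF p(1)] p(2) t(1,2)] by (simp add: H1_def[symmetric])
  qed
  have bests: "best_upper_const {0<..<pi/2} (\<lambda>t. sin t / t) (\<lambda>t. H1 (cos t) p) (lambda_const p)"
    if "p \<in> {0<..p1}" for p
    using that by (intro best_upper_const_lambda) auto
  have bestd: "best_upper_const {0<..<pi/2} (\<lambda>t. sin t / t) (\<lambda>t. H1 (cos t) p) (delta_const p t0)"
    if "p \<in> {p1<..p0}" "critical_point p t0" for p t0
    using that p1_pos by (intro best_upper_const_delta) auto
  have ex1: "\<exists>!t0. critical_point p t0" if "p \<in> {p1<..p0}" for p
    using that by (intro ex1_critical_point) auto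
  show ?thesis
    by (rule conjI[OF allI[OF part1]] conjI[OF p0_approx] conjI[OF p1_approx] conjI[OF mono]
        conjI ballI part2 bests ex1 allI impI part3 bestd | assumption)+
qed

end
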